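(* Let $(R;\circ,\ast,\rightarrow,\leadsto,0,1)$ be a conditional double CI-poset with partial order $\le$ satisfying the pseudoinvolution, divisibility, associativity and pseudo-effect algebra conditions. Define a partial operation $\oplus$ on $R$ by: $x\oplus y$ is defined iff $x\le y^-$, and then $x\oplus y:=(y^-\ast x^-)^{\sim}=(x^{\sim}\circ y^{\sim})^-$. Then $(R;\oplus,0,1)$ is a pseudo-effect algebra. Moreover, the partial order induced by $\oplus$ coincides with the initial order $\le$.
   Context: A conditional double CI-poset is a system $(R;\circ,\ast,\rightarrow,\leadsto,0,1)$ on a bounded poset $(R;\le,0,1)$ (least element $0$, greatest element $1$), with partial binary operations $\circ,\ast,\rightarrow,\leadsto$, such that for all $x,y,z\in R$: (a) $x\rightarrow y$ is defined iff $y\le x$; $x\leadsto y$ is defined iff $y\le x$; $x\circ y$ is defined iff $y\rightarrow 0\le x$; $x\ast y$ is defined iff $y\leadsto 0\le x$; (b) $x\circ 1=1\circ x=x\ast 1=1\ast x=x$; (c) if $x\circ y$ and $x\leadsto z$ are defined, then $x\circ y\le z$ iff $y\le x\leadsto z$; if $x\ast y$ and $x\rightarrow z$ are defined, then $x\ast y\le z$ iff $y\le x\rightarrow z$. Write $x^-:=x\rightarrow 0$, $x^{\sim}:=x\leadsto 0$. Additional conditions, for all $x,y,z\in R$: - (pseudoinvolution) $x\le y$ implies $y^-\le x^-$ and $y^{\sim}\le x^{\sim}$; and $(x^-)^{\sim}=x=(x^{\sim})^-$; - (divisibility) $x\le y\iff x=y\circ(y\leadsto x)=y\ast(y\rightarrow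 x)$ (with all these terms defined); - (associativity) $(x\circ y)\circ z=x\circ(y\circ z)$ and $(x\ast y)\ast z=x\ast(y\ast z)$, in the sense that if one side is defined so is the other and equality holds; - (pseudo-effect algebra condition) $(y^-\ast x^-)^{\sim}=(x^{\sim}\circ y^{\sim})^-$ (whenever defined, i.e. whenever $x\le y^-$). A pseudo-effect algebra (PEA) is a partial algebra $(P;\oplus,0,1)$, with $\oplus$ a partial binary operation and $0,1$ constants, such that for all $a,b,c\in P$: (PE1) $a\oplus b$ and $(a\oplus b)\oplus c$ exist iff $b\oplus c$ and $a\oplus(b\oplus c)$ exist, and in this case $(a\oplus b)\oplus c=a\oplus(b\oplus c)$; (PE2) there exist exactly one $d\in P$ and exactly one $e\in P$ with $a\oplus d=e\oplus a=1$; (PE3) if $a\oplus b$ exists, there are $d,e\in P$ with $a\oplus b=d\oplus a=b\oplus e$; (PE4) if $a\oplus 1$ or $1\oplus a$ exists, then $a=0$. The partial order induced by $\oplus$ is: $a\le b$ iff $c\oplus a=b$ for some $c\in P$, equivalently iff $a\oplus d=b$ for some $d\in P$. *)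

theory Defs
  imports Main
begin

text \<open>
  A partial binary operation on a set is a function into \<^typ>\<open>'a option\<close>, with \<^const>\<open>None\<close> for
  ``undefined''. The underlying set is a whole (arbitrary) type; bounded posets are types of
  class \<^class>\<open>order_bot\<close> and \<^class>\<open>order_top\<close>, with \<open>0\<close> and \<open>1\<close> rendered as \<open>bot\<close> and \<open>top\<close>.
  An equation \<open>t = Some x\<close> says that \<open>t\<close> is defined and has value \<open>x\<close>. Nested partial terms
  are built with \<open>Option.bind\<close>, so an equation between two of them says that if one side is
  defined then so is the other and the values agree.
  The operations \<open>\<rightarrow>\<close> and \<open>\<leadsto>\<close> are called \<open>imp\<close> and \<open>rimp\<close>.
\<close>

type_synonym 'a partial_op = "'a \<Rightarrow> 'a \<Rightarrow> 'a option"

text \<open>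
  The terms \<open>x \<rightarrow> 0\<close> and \<open>x \<leadsto> 0\<close>. They are always defined in a conditional double CI-poset,
  because \<open>0 \<le> x\<close>; so \<open>the\<close> is harmless there.
\<close>

definition lneg :: "'a::{order_bot,order_top} partial_op \<Rightarrow> 'a \<Rightarrow> 'a" where
  "lneg imp x = the (imp x bot)"

definition rneg :: "'a::{order_bot,order_top} partial_op \<Rightarrow> 'a \<Rightarrow> 'a" where
  "rneg rimp x = the (rimp x bot)"

definition cond_double_CI_poset ::
  "'a::{order_bot,order_top} partial_op \<Rightarrow> 'a partial_op \<Rightarrow> 'a partial_op \<Rightarrow> 'a partial_op \<Rightarrow> bool"
where
  "cond_double_CI_poset circ ast imp rimp \<longleftrightarrow>
     (\<forall>x y. imp x y \<noteq> None \<longleftrightarrow> y \<le> x) \<and>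
     (\<forall>x y. rimp x y \<noteq> None \<longleftrightarrow> y \<le> x) \<and>
     (\<forall>x y. circ x y \<noteq> None \<longleftrightarrow> lneg imp y \<le> x) \<and>
     (\<forall>x y. ast x y \<noteq> None \<longleftrightarrow> rneg rimp y \<le> x) \<and>
     (\<forall>x. circ x top = Some x \<and> circ top x = Some x \<and>
          ast x top = Some x \<and> ast top x = Some x) \<and>
     (\<forall>x y z p r. circ x y = Some p \<longrightarrow> rimp x z = Some r \<longrightarrow> (p \<le> z \<longleftrightarrow> y \<le> r)) \<and>
     (\<forall>x y z p r. ast x y = Some p \<longrightarrow> imp x z = Some r \<longrightarrow> (p \<le> z \<longleftrightarrow> y \<le> r))"

definition pseudoinvolution ::
  "'a::{order_bot,order_top} partial_op \<Rightarrow> 'a partial_op \<Rightarrow> bool"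
where
  "pseudoinvolution imp rimp \<longleftrightarrow>
     (\<forall>x y. x \<le> y \<longrightarrow> lneg imp y \<le> lneg imp x \<and> rneg rimp y \<le> rneg rimp x) \<and>
     (\<forall>x. rneg rimp (lneg imp x) = x \<and> lneg imp (rneg rimp x) = x)"

definition divisibility ::
  "'a::{order_bot,order_top} partial_op \<Rightarrow> 'a partial_op \<Rightarrow> 'a partial_op \<Rightarrow> 'a partial_op \<Rightarrow> bool"
where
  "divisibility circ ast imp rimp \<longleftrightarrow>
     (\<forall>x y. x \<le> y \<longleftrightarrow>
        Option.bind (rimp y x) (\<lambda>s. circ y s) = Some x \<and>
        Option.bind (imp y x) (\<lambda>s. ast y s) = Some x)"

definition partial_assoc :: "'a partial_op \<Rightarrow> bool" where
  "partial_assoc f \<longleftrightarrow>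
     (\<forall>x y z. Option.bind (f x y) (\<lambda>s. f s z) = Option.bind (f y z) (\<lambda>t. f x t))"

definition pseudo_effect_condition ::
  "'a::{order_bot,order_top} partial_op \<Rightarrow> 'a partial_op \<Rightarrow> 'a partial_op \<Rightarrow> 'a partial_op \<Rightarrow> bool"
where
  "pseudo_effect_condition circ ast imp rimp \<longleftrightarrow>
     (\<forall>x y. x \<le> lneg imp y \<longrightarrow>
        map_option (rneg rimp) (ast (lneg imp y) (lneg imp x)) =
        map_option (lneg imp) (circ (rneg rimp x) (rneg rimp y)))"

definition CI_oplus ::
  "'a::{order_bot,order_top} partial_op \<Rightarrow> 'a partial_op \<Rightarrow> 'a partial_op \<Rightarrow> 'a partial_op"
where
  "CI_oplus ast imp rimp x y =
     (if x \<le> lneg imp y then map_option (rneg rimp) (ast (lneg imp y) (lneg imp x)) else None)"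

text \<open>
  \<open>CI_oplus\<close> is defined precisely on the intended domain, and the second expression for
  \<open>x \<oplus> y\<close>, namely \<open>(x\<^sup>\<sim> \<circ> y\<^sup>\<sim>)\<^sup>-\<close>, gives the same operation.
\<close>

lemma CI_oplus_defined_iff:
  assumes "cond_double_CI_poset circ ast imp rimp" and "pseudoinvolution imp rimp"
  shows "CI_oplus ast imp rimp x y \<noteq> None \<longleftrightarrow> x \<le> lneg imp y"
  using assms unfolding cond_double_CI_poset_def pseudoinvolution_def CI_oplus_def
  by (metis option.map_disc_iff)

lemma CI_oplus_eq_circ:
  assumes "pseudo_effect_condition circ ast imp rimp"
  shows "CI_oplus ast imp rimp x y =
    (if x \<le> lneg imp y then map_option (lneg imp) (circ (rneg rimp x) (rneg rimp y)) else None)"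
  using assms unfolding pseudo_effect_condition_def CI_oplus_def by simp

text \<open>(PE1) is the predicate \<^const>\<open>partial_assoc\<close>.\<close>

definition pseudo_effect_algebra :: "'a partial_op \<Rightarrow> 'a \<Rightarrow> 'a \<Rightarrow> bool" where
  "pseudo_effect_algebra opl zero one \<longleftrightarrow>
     partial_assoc opl \<and>
     (\<forall>a. (\<exists>!d. opl a d = Some one) \<and> (\<exists>!e. opl e a = Some one)) \<and>
     (\<forall>a b. opl a b \<noteq> None \<longrightarrow> (\<exists>d e. opl a b = opl d a \<and> opl a b = opl b e)) \<and>
     (\<forall>a. opl a one \<noteq> None \<or> opl one a \<noteq> None \<longrightarrow> a = zero)"

definition induced_le :: "'a partial_op \<Rightarrow> 'a \<Rightarrow> 'a \<Rightarrow> bool" where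
  "induced_le opl a b \<longleftrightarrow> (\<exists>c. opl c a = Some b)"

lemma induced_le_iff_right:
  assumes "pseudo_effect_algebra opl zero one"
  shows "induced_le opl a b \<longleftrightarrow> (\<exists>d. opl a d = Some b)"
  using assms unfolding pseudo_effect_algebra_def induced_le_def
  by (metis option.distinct(1))

end

theory Submission
  imports Defs
begin

text \<open>
  The two negations are mutually inverse order-reversing bijections, so the two forms of the sum,
  \<open>(x \<oplus> y)\<^sup>- = y\<^sup>- \<ast> x\<^sup>-\<close> and \<open>(x \<oplus> y)\<^sup>\<sim> = x\<^sup>\<sim> \<circ> y\<^sup>\<sim>\<close>, translate every statement about \<open>\<oplus>\<close>
  into one about \<open>\<ast>\<close> or \<open>\<circ>\<close>; the proof picks the form that makes the statement easy.

  Associativity of \<open>\<oplus>\<close> is associativity of \<open>\<ast>\<close> read through the first form. Adjointness with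
  \<open>z = 0\<close> shows that a product vanishes exactly when its factors are opposite negations of each
  other, which gives the unique complements. Adjointness with \<open>z = x\<close> shows that a product lies
  below its left factor \<open>x\<close>; through the two forms this says that a sum lies above both summands.
  Conversely, divisibility turns \<open>a \<le> b\<close> into a product with left factor \<open>a\<^sup>-\<close> or \<open>a\<^sup>\<sim>\<close>, that is,
  into a sum with value \<open>b\<close> in which \<open>a\<close> is the right or the left summand. So \<open>a \<le> b\<close> is equivalent
  to \<open>a\<close> being a left summand of \<open>b\<close>, and also to its being a right summand. The induced order is
  therefore \<open>\<le>\<close>, and the exchange property (PE3) follows, since each summand of \<open>a \<oplus> b\<close> lies below it
  and so occurs as a summand on the other side as well.
\<close>

locale pseudo_effect_CI_poset =
  fixes circ ast imp rimp :: "'a::{order_bot,order_top} partial_op"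
  assumes CI: "cond_double_CI_poset circ ast imp rimp"
    and invol: "pseudoinvolution imp rimp"
    and divis: "divisibility circ ast imp rimp"
    and ast_assoc: "partial_assoc ast"
    and pe_cond: "pseudo_effect_condition circ ast imp rimp"
begin

abbreviation ln :: "'a \<Rightarrow> 'a" where "ln \<equiv> lneg imp"
abbreviation rn :: "'a \<Rightarrow> 'a" where "rn \<equiv> rneg rimp"
abbreviation opl :: "'a partial_op" where "opl \<equiv> CI_oplus ast imp rimp"

lemma neg_inverse [simp]: "rn (ln x) = x" "ln (rn x) = x"
  using invol by (auto simp: pseudoinvolution_def)

lemma ln_le_iff: "ln y \<le> ln x \<longleftrightarrow> x \<le> y"
  using invol by (metis pseudoinvolution_def)

lemma rn_le_iff: "rn y \<le> rn x \<longleftrightarrow> x \<le> y"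
  using invol by (metis pseudoinvolution_def)

lemma rn_le_swap: "rn x \<le> y \<longleftrightarrow> ln y \<le> x"
  using ln_le_iff[of y "rn x"] by simp

lemma le_rn_swap: "x \<le> rn y \<longleftrightarrow> y \<le> ln x"
  using ln_le_iff[of "rn y" x] by simp

lemma ln_bounds: "ln top = bot" "ln bot = top"
proof -
  have "ln top \<le> bot"
    using rn_le_swap[of bot top] by simp
  then show "ln top = bot"
    by (simp add: bot_unique)
  have "top \<le> ln bot"
    using le_rn_swap[of bot top] by simp
  then show "ln bot = top"
    by (simp add: top_unique)
qed

lemma rn_bounds: "rn top = bot" "rn bot = top"
  using neg_inverse(1)[of bot] neg_inverse(1)[of top] by (simp_all add: ln_bounds)

lemma circ_defined: "circ x y \<noteq> None \<longleftrightarrow> ln y \<le> x"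
  and ast_defined: "ast x y \<noteq> None \<longleftrightarrow> rn y \<le> x"
  and imp_defined: "imp x y \<noteq> None \<longleftrightarrow> y \<le> x"
  and rimp_defined: "rimp x y \<noteq> None \<longleftrightarrow> y \<le> x"
  and circ_top: "circ x top = Some x"
  and ast_top: "ast x top = Some x"
  using CI by (simp_all add: cond_double_CI_poset_def)

lemma circ_adjoint: "circ x y = Some p \<Longrightarrow> rimp x z = Some r \<Longrightarrow> p \<le> z \<longleftrightarrow> y \<le> r"
  and ast_adjoint: "ast x y = Some p \<Longrightarrow> imp x z = Some r \<Longrightarrow> p \<le> z \<longleftrightarrow> y \<le> r"
  using CI unfolding cond_double_CI_poset_def by blast+

lemma imp_bot: "imp x bot = Some (ln x)" and rimp_bot: "rimp x bot = Some (rn x)"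
  using imp_defined[of x bot] rimp_defined[of x bot] by (auto simp: lneg_def rneg_def)

text \<open>The unit law \<open>x \<circ> 1 = x\<close> and adjointness force \<open>x \<leadsto> x = 1\<close>, so nothing in the second
  argument can push the product above \<open>x\<close>; likewise for \<open>\<ast>\<close> and \<open>\<rightarrow>\<close>.\<close>

lemma circ_le_left:
  assumes "circ x y = Some p" shows "p \<le> x"
proof -
  obtain r where r: "rimp x x = Some r"
    using rimp_defined[of x x] by auto
  have "top \<le> r"
    using circ_adjoint[OF circ_top r] by simp
  then have "y \<le> r"
    using order_trans top_greatest by blast
  then show ?thesis
    using circ_adjoint[OF assms r] by simp
qed

lemma ast_le_left:
  assumes "ast x y = Some p" shows "p \<le> x"
proof -
  obtain r where r: "imp x x = Some r"
    using imp_defined[of x x] by auto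
  have "top \<le> r"
    using ast_adjoint[OF ast_top r] by simp
  then have "y \<le> r"
    using order_trans top_greatest by blast
  then show ?thesis
    using ast_adjoint[OF assms r] by simp
qed

text \<open>Adjointness with \<open>z = 0\<close> bounds the second factor of a vanishing product from above by a
  negation of the first, and definedness bounds it from below by the same element.\<close>

lemma circ_eq_bot_iff: "circ x y = Some bot \<longleftrightarrow> y = rn x"
proof
  assume xy: "circ x y = Some bot"
  have "y \<le> rn x"
    using circ_adjoint[OF xy rimp_bot] by simp
  moreover have "rn x \<le> y"
    using xy circ_defined[of x y] by (simp add: rn_le_swap)
  ultimately show "y = rn x" by simp
next
  assume y: "y = rn x"
  then obtain p where p: "circ x y = Some p"
    using circ_defined[of x y] by auto
  then have "p \<le> bot"
    using circ_adjoint[OF p rimp_bot] y by simp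
  then show "circ x y = Some bot"
    using p by (simp add: bot_unique)
qed

lemma ast_eq_bot_iff: "ast x y = Some bot \<longleftrightarrow> y = ln x"
proof
  assume xy: "ast x y = Some bot"
  have "y \<le> ln x"
    using ast_adjoint[OF xy imp_bot] by simp
  moreover have "ln x \<le> y"
    using xy ast_defined[of x y] by (simp add: rn_le_swap)
  ultimately show "y = ln x" by simp
next
  assume y: "y = ln x"
  then obtain p where p: "ast x y = Some p"
    using ast_defined[of x y] by auto
  then have "p \<le> bot"
    using ast_adjoint[OF p imp_bot] y by simp
  then show "ast x y = Some bot"
    using p by (simp add: bot_unique)
qed

text \<open>The side condition \<open>x \<le> y\<^sup>-\<close> of the sum is exactly the domain condition of each of the two
  products, so the sum can be handled without case distinction.\<close>

lemma opl_ast: "opl x y = map_option rn (ast (ln y) (ln x))"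
  using ast_defined[of "ln y" "ln x"] by (auto simp: CI_oplus_def)

lemma opl_circ: "opl x y = map_option ln (circ (rn x) (rn y))"
  using circ_defined[of "rn x" "rn y"]
  by (auto simp: CI_oplus_eq_circ[OF pe_cond] le_rn_swap)

lemma opl_eq_iff_ast: "opl x y = Some z \<longleftrightarrow> ast (ln y) (ln x) = Some (ln z)"
  by (auto simp: opl_ast)

lemma opl_eq_iff_circ: "opl x y = Some z \<longleftrightarrow> circ (rn x) (rn y) = Some (rn z)"
  by (auto simp: opl_circ)

lemma opl_defined: "opl x y \<noteq> None \<longleftrightarrow> x \<le> ln y"
  by (rule CI_oplus_defined_iff[OF CI invol])

text \<open>Reading the sums through \<open>\<ast>\<close> reverses the order of the three elements, and the negation
  between the two products cancels.\<close>

lemma opl_assoc: "partial_assoc opl"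
proof -
  have "Option.bind (opl a b) (\<lambda>s. opl s c) = Option.bind (opl b c) (opl a)" for a b c
  proof -
    have "Option.bind (opl a b) (\<lambda>s. opl s c)
        = map_option rn (Option.bind (ast (ln b) (ln a)) (ast (ln c)))"
      by (cases "ast (ln b) (ln a)") (simp_all add: opl_ast)
    also have "\<dots> = map_option rn (Option.bind (ast (ln c) (ln b)) (\<lambda>s. ast s (ln a)))"
      using ast_assoc by (simp add: partial_assoc_def)
    also have "\<dots> = Option.bind (opl b c) (opl a)"
      by (cases "ast (ln c) (ln b)") (simp_all add: opl_ast)
    finally show ?thesis .
  qed
  then show ?thesis
    by (simp add: partial_assoc_def)
qed

lemma opl_right_complement_iff: "opl a d = Some top \<longleftrightarrow> d = rn a"
proof -
  have "opl a d = Some top \<longleftrightarrow> rn d = rn (rn a)"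
    by (simp add: opl_eq_iff_circ rn_bounds circ_eq_bot_iff)
  then show ?thesis
    by (metis neg_inverse(2))
qed

lemma opl_left_complement_iff: "opl e a = Some top \<longleftrightarrow> e = ln a"
proof -
  have "opl e a = Some top \<longleftrightarrow> ln e = ln (ln a)"
    by (simp add: opl_eq_iff_ast ln_bounds ast_eq_bot_iff)
  then show ?thesis
    by (metis neg_inverse(1))
qed

text \<open>Each form of the sum exhibits one summand as the left factor of a product. That factor bounds
  the product from above, and divisibility provides the other factor.\<close>

lemma right_summand_iff_le: "(\<exists>c. opl c a = Some b) \<longleftrightarrow> a \<le> b"
proof
  assume "\<exists>c. opl c a = Some b"
  then show "a \<le> b"
    unfolding opl_eq_iff_ast using ast_le_left ln_le_iff by blast
next
  assume "a \<le> b"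
  then have "Option.bind (imp (ln a) (ln b)) (ast (ln a)) = Some (ln b)"
    using divis ln_le_iff by (auto simp: divisibility_def)
  then obtain s where "ast (ln a) s = Some (ln b)"
    by (auto simp: bind_eq_Some_conv)
  then have "opl (rn s) a = Some b"
    by (simp add: opl_eq_iff_ast)
  then show "\<exists>c. opl c a = Some b" ..
qed

lemma left_summand_iff_le: "(\<exists>d. opl a d = Some b) \<longleftrightarrow> a \<le> b"
proof
  assume "\<exists>d. opl a d = Some b"
  then show "a \<le> b"
    unfolding opl_eq_iff_circ using circ_le_left rn_le_iff by blast
next
  assume "a \<le> b"
  then have "Option.bind (rimp (rn a) (rn b)) (circ (rn a)) = Some (rn b)"
    using divis rn_le_iff by (auto simp: divisibility_def)
  then obtain s where "circ (rn a) s = Some (rn b)"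
    by (auto simp: bind_eq_Some_conv)
  then have "opl a (ln s) = Some b"
    by (simp add: opl_eq_iff_circ)
  then show "\<exists>d. opl a d = Some b" ..
qed

lemma opl_exchange:
  assumes "opl a b \<noteq> None"
  shows "\<exists>d e. opl a b = opl d a \<and> opl a b = opl b e"
proof -
  obtain c where c: "opl a b = Some c"
    using assms by auto
  then have "a \<le> c" "b \<le> c"
    using left_summand_iff_le right_summand_iff_le by blast+
  then obtain d e where "opl d a = Some c" "opl b e = Some c"
    using left_summand_iff_le right_summand_iff_le by meson
  then show ?thesis
    using c by metis
qed

lemma opl_top_defined:
  assumes "opl a top \<noteq> None \<or> opl top a \<noteq> None"
  shows "a = bot"
proof -
  have "a \<le> ln top \<or> top \<le> ln a"
    using assms by (simp only: opl_defined)
  then have "a \<le> ln top"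
    using le_rn_swap[of a top] by (auto simp: ln_bounds rn_bounds)
  then show ?thesis
    by (simp add: ln_bounds bot_unique)
qed

lemma opl_pseudo_effect_algebra: "pseudo_effect_algebra opl bot top"
proof -
  have "\<exists>!d. opl a d = Some top" for a
    by (simp add: opl_right_complement_iff)
  moreover have "\<exists>!e. opl e a = Some top" for a
    by (simp add: opl_left_complement_iff)
  ultimately show ?thesis
    unfolding pseudo_effect_algebra_def
    by (intro conjI allI impI opl_assoc opl_exchange opl_top_defined)
qed

lemma induced_le_opl: "induced_le opl a b \<longleftrightarrow> a \<le> b"
  by (simp add: induced_le_def right_summand_iff_le)

end

theorem theorem5p2:
  fixes circ ast imp rimp :: "'a::{order_bot,order_top} \<Rightarrow> 'a \<Rightarrow> 'a option"
  assumes "cond_double_CI_poset circ ast imp rimp"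
    and "pseudoinvolution imp rimp"
    and "divisibility circ ast imp rimp"
    and "partial_assoc circ"
    and "partial_assoc ast"
    and "pseudo_effect_condition circ ast imp rimp"
  shows "pseudo_effect_algebra (CI_oplus ast imp rimp) bot top \<and>
         (\<forall>a b. induced_le (CI_oplus ast imp rimp) a b \<longleftrightarrow> a \<le> b)"
proof -
  interpret pseudo_effect_CI_poset circ ast imp rimp
    by unfold_locales (fact assms)+
  show ?thesis
    using opl_pseudo_effect_algebra induced_le_opl by blast
qed

end
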